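(* Let $(F_k(q))_{k\ge 0}$ be a $q$-holonomic sequence of order $J$ and let $L=\sum_{i=0}^{J}a_i(q^k)\sigma^i\in\operatorname{ann}F_k(q)$, with $a_i(x)\in\mathbb{K}(q)[x,x^{-1}]$, be such that $$\gcd(a_0(x),a_J(q^i x))=1\quad\text{for all } i\in\mathbb{N}.$$ Then for a Laurent polynomial $\tilde p(x)\in\mathbb{K}(q)[x,x^{-1}]$, the following are equivalent: (1) there exist rational functions $u_0(x),\dots,u_{J-1}(x)\in\mathbb{K}(q)(x)$ such that $$\tilde p(q^k)F_k(q)=\Delta\Big(\sum_{i=0}^{J-1}u_i(q^k)F_{k+i}(q)\Big);$$ (2) $\tilde p(x)=L^{\ast}(p(x))$ for some Laurent polynomial $p(x)\in\mathbb{K}(q)[x,x^{-1}]$.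
   Context: $\mathbb{K}$ is a field of characteristic zero, $q$ is an indeterminate, $\mathbb{N}=\{0,1,2,\dots\}$. Sequences take values in a field containing $\mathbb{K}(q)$. The shift operator is $\sigma F_k(q)=F_{k+1}(q)$ (and $\sigma a(q^k)=a(q^{k+1})$), and $\Delta=\sigma-1$, i.e. $\Delta G_k=G_{k+1}-G_k$. A sequence $(F_k(q))_{k=0}^\infty$ is $q$-holonomic if there exist $J\in\mathbb{N}$ and Laurent polynomials $a_0(x),\dots,a_J(x)\in\mathbb{K}(q)[x,x^{-1}]$ with $a_J(x)\ne0$ such that $\sum_{i=0}^{J}a_i(q^k)F_{k+i}(q)=0$ for all $k$. Such a relation is said to have order $J$, and the order of $F_k(q)$ is the minimum order of all such recurrences. The annihilator is $\operatorname{ann}F_k(q)=\{L=\sum_{i}a_i(q^k)\sigma^i\in\mathbb{K}(q)[q^k,q^{-k}][\sigma] : L(F_k(q))=0\}$. For $L=\sum_{i=0}^{J}a_i(q^k)\sigma^i$ the adjoint acts on $p(x)\in\mathbb{K}(q)(x)$ by $L^{\ast}(p(x))=\sum_{i=0}^{J}a_i(q^{-i}x)\,p(q^{-i}x)$. The gcd is taken in $\mathbb{K}(q)[x,x^{-1}]$ (up to units). Identities involving rational functions evaluated at $q^k$ are understood at those $k$ where both sides are defined. *)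

theory Defs
  imports "HOL-Computational_Algebra.Computational_Algebra"
begin

type_synonym 'k q_field = "'k poly fract"

type_synonym 'k ratfun = "'k q_field poly fract"

definition qvar :: "'k::field_char_0 q_field"
  where "qvar = Fract [:0, 1:] 1"

definition xvar :: "'k::field_char_0 ratfun"
  where "xvar = Fract [:0, 1:] 1"

(* Some representation, equivalently the reduced one, has a denominator that does not vanish
   at c. *)
definition ratfun_defined :: "'k::field_char_0 ratfun \<Rightarrow> 'k q_field \<Rightarrow> bool"
  where "ratfun_defined r c \<longleftrightarrow> (\<exists>a b. r = Fract a b \<and> poly b c \<noteq> 0)"

(* Meaningful only if ratfun_defined r c. *)
definition ratfun_eval :: "'k::field_char_0 ratfun \<Rightarrow> 'k q_field \<Rightarrow> 'k q_field"
  where "ratfun_eval r c =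
    (THE v. \<exists>a b. r = Fract a b \<and> poly b c \<noteq> 0 \<and> v = poly a c / poly b c)"

lemma ratfun_eval_Fract:
  assumes "poly b c \<noteq> 0"
  shows "ratfun_eval (Fract a b) c = poly a c / poly b c"
  unfolding ratfun_eval_def
proof (rule the_equality)
  fix v
  assume "\<exists>a' b'. Fract a b = Fract a' b' \<and> poly b' c \<noteq> 0 \<and> v = poly a' c / poly b' c"
  then obtain a' b' where *: "Fract a b = Fract a' b'" "poly b' c \<noteq> 0" "v = poly a' c / poly b' c"
    by blast
  have "b \<noteq> 0" "b' \<noteq> 0"
    using assms *(2) by auto
  with *(1) have "a * b' = a' * b"
    by (simp add: eq_fract)
  then have "poly a c * poly b' c = poly a' c * poly b c"
    by (metis poly_mult)
  then show "v = poly a c / poly b c"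
    using assms *(2,3) by (simp add: frac_eq_eq)
qed (use assms in blast)

(* r(x) becomes r(c x), for nonzero c. *)
definition ratfun_scale :: "'k::field_char_0 q_field \<Rightarrow> 'k ratfun \<Rightarrow> 'k ratfun"
  where "ratfun_scale c r =
    (THE s. \<exists>a b. b \<noteq> 0 \<and> r = Fract a b \<and> s = Fract (pcompose a [:0, c:]) (pcompose b [:0, c:]))"

lemma ratfun_scale_Fract:
  assumes "c \<noteq> 0" "b \<noteq> 0"
  shows "ratfun_scale c (Fract a b) = Fract (pcompose a [:0, c:]) (pcompose b [:0, c:])"
  unfolding ratfun_scale_def
proof (rule the_equality)
  have nz: "pcompose d [:0, c:] \<noteq> 0" if "d \<noteq> 0" for d
    using that assms(1) by (simp add: pcompose_eq_0_iff)
  fix s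
  assume "\<exists>a' b'. b' \<noteq> 0 \<and> Fract a b = Fract a' b' \<and>
    s = Fract (pcompose a' [:0, c:]) (pcompose b' [:0, c:])"
  then obtain a' b' where *: "b' \<noteq> 0" "Fract a b = Fract a' b'"
      "s = Fract (pcompose a' [:0, c:]) (pcompose b' [:0, c:])"
    by blast
  then have "a * b' = a' * b"
    using assms by (simp add: eq_fract)
  then have "pcompose a [:0, c:] * pcompose b' [:0, c:] = pcompose a' [:0, c:] * pcompose b [:0, c:]"
    by (metis pcompose_mult)
  then show "s = Fract (pcompose a [:0, c:]) (pcompose b [:0, c:])"
    using *(1,3) assms(2) nz by (simp add: eq_fract)
qed (use assms in blast)

(* The ring of Laurent polynomials, realised inside the field of rational functions. *)
definition laurent :: "'k::field_char_0 ratfun set"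
  where "laurent = {Fract f 1 / xvar ^ n |f n. True}"

definition laurent_dvd :: "'k::field_char_0 ratfun \<Rightarrow> 'k ratfun \<Rightarrow> bool"
  where "laurent_dvd a b \<longleftrightarrow> (\<exists>c\<in>laurent. b = a * c)"

(* gcds in the Laurent polynomial ring are unique up to units only, hence a predicate. *)
definition is_laurent_gcd :: "'k::field_char_0 ratfun \<Rightarrow> 'k ratfun \<Rightarrow> 'k ratfun \<Rightarrow> bool"
  where "is_laurent_gcd d a b \<longleftrightarrow>
    d \<in> laurent \<and> laurent_dvd d a \<and> laurent_dvd d b \<and>
    (\<forall>e\<in>laurent. laurent_dvd e a \<and> laurent_dvd e b \<longrightarrow> laurent_dvd e d)"

(* Presents 'e as an extension field of the coefficient field; injectivity is automatic. *)
definition field_embedding :: "('a::field \<Rightarrow> 'e::field) \<Rightarrow> bool"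
  where "field_embedding h \<longleftrightarrow>
    h 1 = 1 \<and> (\<forall>a b. h (a + b) = h a + h b) \<and> (\<forall>a b. h (a * b) = h a * h b)"

(* An operator (sum over i of a_i(q^k) sigma^i) is stored as the polynomial in sigma with
   coefficients a_i(x).  Only coefficients and degree of this polynomial are used: polynomial
   multiplication is not operator composition. *)
type_synonym 'k q_operator = "'k ratfun poly"

definition q_apply ::
    "('k::field_char_0 q_field \<Rightarrow> 'e::field) \<Rightarrow> 'k q_operator \<Rightarrow> (nat \<Rightarrow> 'e) \<Rightarrow> nat \<Rightarrow> 'e"
  where "q_apply h L F k =
    (\<Sum>i\<le>degree L. h (ratfun_eval (coeff L i) (qvar ^ k)) * F (k + i))"

definition q_ann ::
    "('k::field_char_0 q_field \<Rightarrow> 'e::field) \<Rightarrow> (nat \<Rightarrow> 'e) \<Rightarrow> 'k q_operator set"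
  where "q_ann h F = {L. (\<forall>i. coeff L i \<in> laurent) \<and> (\<forall>k. q_apply h L F k = 0)}"

definition has_q_recurrence ::
    "('k::field_char_0 q_field \<Rightarrow> 'e::field) \<Rightarrow> (nat \<Rightarrow> 'e) \<Rightarrow> nat \<Rightarrow> bool"
  where "has_q_recurrence h F J \<longleftrightarrow> (\<exists>L\<in>q_ann h F. degree L = J \<and> coeff L J \<noteq> 0)"

definition q_holonomic :: "('k::field_char_0 q_field \<Rightarrow> 'e::field) \<Rightarrow> (nat \<Rightarrow> 'e) \<Rightarrow> bool"
  where "q_holonomic h F \<longleftrightarrow> (\<exists>J. has_q_recurrence h F J)"

definition q_order :: "('k::field_char_0 q_field \<Rightarrow> 'e::field) \<Rightarrow> (nat \<Rightarrow> 'e) \<Rightarrow> nat"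
  where "q_order h F = (LEAST J. has_q_recurrence h F J)"

definition q_adjoint :: "'k::field_char_0 q_operator \<Rightarrow> 'k ratfun \<Rightarrow> 'k ratfun"
  where "q_adjoint L p =
    (\<Sum>i\<le>degree L. ratfun_scale (inverse (qvar ^ i)) (coeff L i) *
                    ratfun_scale (inverse (qvar ^ i)) p)"

definition fwd_diff :: "(nat \<Rightarrow> 'e::ab_group_add) \<Rightarrow> nat \<Rightarrow> 'e"
  where "fwd_diff G k = G (Suc k) - G k"

end

theory Submission
  imports "HOL-Algebra.Algebraic_Closure_Type" Defs
begin

text \<open>One direction is summation by parts.  If $b_i = a_i p$, then $L F = 0$ gives
  $\sum_i b_i(q^k) F_{k+i} = 0$, and moving every shift from $F$ onto the coefficient changes each
  summand by a difference: $b_i(q^{k-i}) F_k - b_i(q^k) F_{k+i}$ telescopes.  Summed over $i$, the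
  coefficients of $F_k$ form $L^*(p)$ (lemmas \<open>summation_by_parts\<close> and
  \<open>adjoint_imp_telescoping\<close>).

  Conversely, a telescoping relation for $\tilde p F$ is a linear relation, with rational
  coefficients $c_0, \dots, c_J$, between $F_k, \dots, F_{k+J}$ for all large $k$.  As $J$ is the
  minimal order, subtracting $r L$ with $r = c_J / a_J$ must leave nothing, since otherwise
  clearing denominators, and multiplying by a polynomial that vanishes at the finitely many
  exceptional $q^k$, would produce a recurrence of smaller order
  (\<open>below_order_imp_coeffs_zero\<close>).  So $c_i = r a_i$ for all $i$.  Eliminating the $u_i$ from
  these equations by applying $x \mapsto q^{-i} x$ and summing leaves $\tilde p = L^*(-r)$
  (\<open>telescoping_imp_rational_adjoint\<close>).

  It remains to see that a rational $r$ with $L^*(r)$ a Laurent polynomial is itself one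
  (\<open>laurent_if_adjoint_laurent\<close>), and here the gcd condition enters.  A rational function is a
  Laurent polynomial iff it has no pole at any nonzero point of the algebraic closure of
  $\mathbb{K}(q)$ (\<open>laurent_iff_regular_at\<close>).  If $r$ has a nonzero pole, the poles of $r$ on
  its orbit under multiplication by powers of $q$ are finite in number, so there is a first one
  $\alpha$ and a last one $\beta = q^n \alpha$.  The summand $a_i(q^{-i} x) r(q^{-i} x)$ of $L^*(r)$
  has its poles moved by $q^i$.  At $\alpha$ only the summand $i = 0$ could have a pole, and at
  $q^J \beta$ only the summand $i = J$; as $L^*(r)$ has no poles, $a_0$ vanishes at $\alpha$ and
  $a_J$ vanishes at $q^n \alpha$.  Then $a_0(x)$ and $a_J(q^n x)$ have a common nonzero zero and
  are not coprime.\<close>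

section \<open>Polynomials at points of the algebraic closure\<close>

text \<open>A nonzero element of minimal degree divides every other one, as remainders stay in the ideal.
  The lemma is applied to the ideal of denominators of a rational function and to the ideal of
  polynomials that vanish at an algebraic point.\<close>

lemma field_poly_ideal_principal:
  fixes I :: "'a::field poly set"
  assumes diff: "\<And>a b. a \<in> I \<Longrightarrow> b \<in> I \<Longrightarrow> a - b \<in> I"
    and mult: "\<And>a c. a \<in> I \<Longrightarrow> c * a \<in> I"
    and nonzero: "\<exists>a\<in>I. a \<noteq> 0"
  obtains g where "g \<in> I" "g \<noteq> 0" "\<And>b. b \<in> I \<Longrightarrow> g dvd b"
proof -
  obtain g where g: "g \<in> I" "g \<noteq> 0"
    and min: "\<And>b. b \<in> I \<Longrightarrow> b \<noteq> 0 \<Longrightarrow> degree g \<le> degree b"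
    using nonzero ex_has_least_nat[of "\<lambda>a. a \<in> I \<and> a \<noteq> 0" _ degree] by blast
  have "g dvd b" if "b \<in> I" for b
  proof (rule ccontr)
    assume "\<not> g dvd b"
    then have nz: "b mod g \<noteq> 0" by (simp add: dvd_eq_mod_eq_0)
    have "b mod g = b - (b div g) * g" by (simp add: minus_div_mult_eq_mod)
    then have "b mod g \<in> I" using diff mult that g by simp
    then show False
      using min nz degree_mod_less[OF g(2), of b] by (metis not_less)
  qed
  with g show thesis using that by blast
qed

definition ac_poly :: "'a::field poly \<Rightarrow> 'a alg_closure \<Rightarrow> 'a alg_closure"
  where "ac_poly p \<alpha> = poly (map_poly to_ac p) \<alpha>"

lemma ac_poly_0 [simp]: "ac_poly 0 \<alpha> = 0"
  by (simp add: ac_poly_def)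

lemma ac_poly_pCons [simp]: "ac_poly (pCons a p) \<alpha> = to_ac a + \<alpha> * ac_poly p \<alpha>"
  by (simp add: ac_poly_def map_poly_pCons)

lemma ac_poly_1 [simp]: "ac_poly 1 \<alpha> = 1"
  by (simp add: one_pCons)

lemma ac_poly_add [simp]: "ac_poly (p + p') \<alpha> = ac_poly p \<alpha> + ac_poly p' \<alpha>"
  by (induction p p' rule: poly_induct2) (auto simp: algebra_simps)

lemma ac_poly_smult [simp]: "ac_poly (smult c p) \<alpha> = to_ac c * ac_poly p \<alpha>"
  by (induction p) (auto simp: algebra_simps)

lemma ac_poly_minus [simp]: "ac_poly (- p) \<alpha> = - ac_poly p \<alpha>"
  by (induction p) (auto simp: algebra_simps)

lemma ac_poly_diff [simp]: "ac_poly (p - p') \<alpha> = ac_poly p \<alpha> - ac_poly p' \<alpha>"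
  using ac_poly_add[of p "- p'" \<alpha>] by simp

lemma ac_poly_mult [simp]: "ac_poly (p * p') \<alpha> = ac_poly p \<alpha> * ac_poly p' \<alpha>"
  by (induction p) (auto simp: algebra_simps)

lemma ac_poly_scale [simp]: "ac_poly (pcompose p [:0, c:]) \<alpha> = ac_poly p (to_ac c * \<alpha>)"
  by (induction p) (auto simp: pcompose_pCons algebra_simps)

lemma ac_poly_to_ac [simp]: "ac_poly p (to_ac c) = to_ac (poly p c)"
  by (induction p) auto

lemma map_poly_to_ac_eq_0_iff: "map_poly to_ac p = 0 \<longleftrightarrow> p = 0"
  by (simp add: map_poly_eq_0_iff)

lemma finite_ac_roots: "p \<noteq> 0 \<Longrightarrow> finite {\<alpha>. ac_poly p \<alpha> = 0}"
  unfolding ac_poly_def by (intro poly_roots_finite) (simp add: map_poly_to_ac_eq_0_iff)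

text \<open>Splitting off the maximal power of $x$ leaves a factor without any root in the algebraic closure,
  hence a constant.\<close>

lemma only_root_zero_imp_monom:
  fixes g :: "'a::field poly"
  assumes "g \<noteq> 0" and "\<And>\<alpha>. ac_poly g \<alpha> = 0 \<Longrightarrow> \<alpha> = 0"
  shows "\<exists>c n. c \<noteq> 0 \<and> g = monom c n"
proof -
  obtain n g' where g: "g = [:0, 1:] ^ n * g'" and nd: "\<not> [:0, 1:] dvd g'"
    using order_decomp[OF assms(1), of 0] by auto
  have "degree g' = 0"
  proof (rule ccontr)
    assume "degree g' \<noteq> 0"
    then have "degree (map_poly to_ac g') > 0"
      by (simp add: degree_map_poly)
    then obtain \<alpha> where \<alpha>: "ac_poly g' \<alpha> = 0"
      using alg_closed_imp_poly_has_root unfolding ac_poly_def by blast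
    then have "ac_poly g \<alpha> = 0" by (simp add: g)
    then have "\<alpha> = 0" using assms(2) by blast
    then have "to_ac (poly g' 0) = 0" using \<alpha> ac_poly_to_ac[of g' 0] by simp
    then have "poly g' 0 = 0" by simp
    with nd show False by (simp add: poly_eq_0_iff_dvd)
  qed
  then obtain c where "g' = [:c:]" by (metis degree_eq_zeroE)
  then have "g = monom c n" "c \<noteq> 0"
    using assms(1) g by (auto simp: monom_altdef)
  then show ?thesis by blast
qed

section \<open>Poles of rational functions\<close>

text \<open>The existential quantifier over all representations spares a reduced form: a fraction that is
  not reduced does not create a pole.\<close>

definition regular_at :: "'k::field_char_0 ratfun \<Rightarrow> 'k q_field alg_closure \<Rightarrow> bool"
  where "regular_at r \<alpha> \<longleftrightarrow> (\<exists>a b. r = Fract a b \<and> ac_poly b \<alpha> \<noteq> 0)"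

definition vanishes_at :: "'k::field_char_0 ratfun \<Rightarrow> 'k q_field alg_closure \<Rightarrow> bool"
  where "vanishes_at r \<alpha> \<longleftrightarrow> (\<exists>a b. r = Fract a b \<and> ac_poly b \<alpha> \<noteq> 0 \<and> ac_poly a \<alpha> = 0)"

lemma ratfun_defined_iff_regular_at: "ratfun_defined r c \<longleftrightarrow> regular_at r (to_ac c)"
  by (simp add: ratfun_defined_def regular_at_def)

lemma regular_at_add [intro]:
  assumes "regular_at r \<alpha>" "regular_at s \<alpha>"
  shows "regular_at (r + s) \<alpha>"
proof -
  obtain a b a' b' where "r = Fract a b" "ac_poly b \<alpha> \<noteq> 0" "s = Fract a' b'" "ac_poly b' \<alpha> \<noteq> 0"
    using assms unfolding regular_at_def by blast
  moreover from this have "b \<noteq> 0" "b' \<noteq> 0" by auto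
  ultimately have "r + s = Fract (a * b' + a' * b) (b * b')" "ac_poly (b * b') \<alpha> \<noteq> 0"
    by auto
  then show ?thesis unfolding regular_at_def by blast
qed

lemma regular_at_mult [intro]:
  assumes "regular_at r \<alpha>" "regular_at s \<alpha>"
  shows "regular_at (r * s) \<alpha>"
proof -
  obtain a b a' b' where "r = Fract a b" "ac_poly b \<alpha> \<noteq> 0" "s = Fract a' b'" "ac_poly b' \<alpha> \<noteq> 0"
    using assms unfolding regular_at_def by blast
  then have "r * s = Fract (a * a') (b * b')" "ac_poly (b * b') \<alpha> \<noteq> 0"
    by auto
  then show ?thesis unfolding regular_at_def by blast
qed

lemma regular_at_poly [intro, simp]: "regular_at (Fract a 1) \<alpha>"
  unfolding regular_at_def by (intro exI[of _ a] exI[of _ 1]) simp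

lemma regular_at_0 [intro, simp]: "regular_at 0 \<alpha>"
  using regular_at_poly[of 0] by (simp add: Zero_fract_def)

lemma regular_at_minus [intro]:
  assumes "regular_at r \<alpha>"
  shows "regular_at (- r) \<alpha>"
  using assms unfolding regular_at_def by (metis minus_fract)

lemma regular_at_diff [intro]:
  assumes "regular_at r \<alpha>" "regular_at s \<alpha>"
  shows "regular_at (r - s) \<alpha>"
  using regular_at_add[OF assms(1) regular_at_minus[OF assms(2)]] by simp

lemma regular_at_sum: "(\<And>i. i \<in> A \<Longrightarrow> regular_at (f i) \<alpha>) \<Longrightarrow> regular_at (\<Sum>i\<in>A. f i) \<alpha>"
  by (induction A rule: infinite_finite_induct) auto

text \<open>If $a$ did not vanish at $\alpha$, its inverse would be regular there, and so would be
  $r = a^{-1} (a r)$.\<close>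

lemma vanishes_at_if_cancels_pole:
  assumes "regular_at a \<alpha>" "regular_at (a * r) \<alpha>" "\<not> regular_at r \<alpha>"
  shows "vanishes_at a \<alpha>"
proof (rule ccontr)
  assume not: "\<not> vanishes_at a \<alpha>"
  obtain f b where fb: "a = Fract f b" "ac_poly b \<alpha> \<noteq> 0"
    using assms(1) unfolding regular_at_def by blast
  with not have "ac_poly f \<alpha> \<noteq> 0"
    unfolding vanishes_at_def by blast
  moreover from this fb have "f \<noteq> 0" "b \<noteq> 0" by auto
  ultimately have "regular_at (inverse a) \<alpha>" "a \<noteq> 0"
    using fb(1) by (auto simp: regular_at_def Zero_fract_def eq_fract)
  then have "regular_at (inverse a * (a * r)) \<alpha>"
    using assms(2) by blast
  moreover have "inverse a * (a * r) = r"
    using \<open>a \<noteq> 0\<close> by (simp flip: mult.assoc)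
  ultimately show False using assms(3) by simp
qed

lemma ratfun_cases:
  obtains a b where "r = Fract a b" "b \<noteq> 0"
  by (cases r) auto

lemma finite_irregular: "finite {\<alpha>. \<not> regular_at r \<alpha>}"
proof -
  obtain a b where "r = Fract a b" "b \<noteq> 0" by (rule ratfun_cases)
  then have "{\<alpha>. \<not> regular_at r \<alpha>} \<subseteq> {\<alpha>. ac_poly b \<alpha> = 0}"
    unfolding regular_at_def by blast
  with finite_ac_roots[OF \<open>b \<noteq> 0\<close>] show ?thesis by (rule rev_finite_subset)
qed

section \<open>Laurent polynomials are the rational functions without nonzero poles\<close>

lemma qvar_nonzero [simp]: "qvar \<noteq> (0::'k::field_char_0 q_field)"
  by (simp add: qvar_def Zero_fract_def eq_fract)

lemma Fract_X_power: "Fract [:0, 1:] 1 ^ n = Fract (monom 1 n) (1 :: 'a::idom poly)"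
proof (induction n)
  case 0
  then show ?case by (simp add: One_fract_def monom_0 flip: one_pCons)
next
  case (Suc n)
  have "[:0, 1:] * monom 1 n = (monom 1 (Suc n) :: 'a poly)" by (simp add: monom_Suc)
  with Suc show ?case by simp
qed

lemma xvar_power: "xvar ^ n = Fract (monom 1 n) (1::'k::field_char_0 q_field poly)"
  by (simp add: xvar_def Fract_X_power)

lemma laurentE:
  assumes "r \<in> laurent"
  obtains f n where "r = Fract f (monom 1 n)"
  using assms unfolding laurent_def by (auto simp: xvar_power)

lemma ac_poly_monom [simp]: "ac_poly (monom c n) \<alpha> = to_ac c * \<alpha> ^ n"
  by (simp add: ac_poly_def map_poly_monom poly_monom)

text \<open>This description makes the closure properties of Laurent polynomials consequences of those of
  \<open>regular_at\<close>.  For the nontrivial direction, the denominators of $r$ form an ideal.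
  Regularity at $\alpha$ provides a denominator that is nonzero at $\alpha$, so the generator
  is nonzero there as well; without nonzero roots it is a monomial.\<close>

lemma laurent_iff_regular_at: "r \<in> laurent \<longleftrightarrow> (\<forall>\<alpha>. \<alpha> \<noteq> 0 \<longrightarrow> regular_at r \<alpha>)"
proof
  assume "r \<in> laurent"
  then obtain f n where r: "r = Fract f (monom 1 n)" by (rule laurentE)
  show "\<forall>\<alpha>. \<alpha> \<noteq> 0 \<longrightarrow> regular_at r \<alpha>"
    unfolding regular_at_def r
    by (intro allI impI exI[of _ f] exI[of _ "monom 1 n"]) simp
next
  assume reg: "\<forall>\<alpha>. \<alpha> \<noteq> 0 \<longrightarrow> regular_at r \<alpha>"
  \<comment> \<open>the ideal of all denominators of $r$\<close>
  define I where "I = {b. \<exists>a. r * Fract b 1 = Fract a 1}"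
  obtain g where g: "g \<in> I" "g \<noteq> 0" and gen: "\<And>b. b \<in> I \<Longrightarrow> g dvd b"
  proof (rule field_poly_ideal_principal[of I])
    fix b b' assume "b \<in> I" "b' \<in> I"
    then obtain a a' where "r * Fract b 1 = Fract a 1" "r * Fract b' 1 = Fract a' 1"
      unfolding I_def by blast
    then have "r * Fract b 1 - r * Fract b' 1 = Fract (a - a') 1" by simp
    moreover have "r * Fract b 1 - r * Fract b' 1 = r * Fract (b - b') 1"
      by (simp flip: right_diff_distrib)
    ultimately show "b - b' \<in> I" unfolding I_def by auto
  next
    fix b c assume "b \<in> I"
    then obtain a where "r * Fract b 1 = Fract a 1"
      unfolding I_def by blast
    then have "r * Fract b 1 * Fract c 1 = Fract (a * c) 1" by simp
    moreover have "r * Fract b 1 * Fract c 1 = r * Fract (c * b) 1"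
      by (simp add: mult.assoc mult.commute)
    ultimately show "c * b \<in> I" unfolding I_def by auto
  next
    obtain a b where "r = Fract a b" "b \<noteq> 0" by (rule ratfun_cases)
    then have "r * Fract b 1 = Fract a 1" by (simp add: eq_fract)
    then show "\<exists>b\<in>I. b \<noteq> 0" unfolding I_def using \<open>b \<noteq> 0\<close> by auto
  qed (use that in blast)
  have "\<alpha> = 0" if "ac_poly g \<alpha> = 0" for \<alpha>
  proof (rule ccontr)
    assume "\<alpha> \<noteq> 0"
    with reg obtain a b where ab: "r = Fract a b" "ac_poly b \<alpha> \<noteq> 0"
      unfolding regular_at_def by blast
    then have "b \<noteq> 0" by auto
    then have "r * Fract b 1 = Fract a 1" using ab by (simp add: eq_fract)
    then have "g dvd b" by (intro gen) (auto simp: I_def)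
    then have "ac_poly b \<alpha> = 0" using \<open>ac_poly g \<alpha> = 0\<close> by (auto elim!: dvdE)
    with ab show False by simp
  qed
  then obtain c n where cn: "c \<noteq> 0" "g = monom c n"
    using only_root_zero_imp_monom[OF \<open>g \<noteq> 0\<close>] by blast
  obtain a where a: "r * Fract g 1 = Fract a 1" using g unfolding I_def by blast
  have "Fract g 1 \<noteq> 0" using g(2) by (simp add: Zero_fract_def eq_fract)
  with a have "r = Fract a 1 / Fract g 1" by (metis nonzero_mult_div_cancel_right)
  also have "\<dots> = Fract (smult (inverse c) a) (monom 1 n)"
  proof -
    have "monom c n = smult c (monom 1 n)" by (simp add: smult_monom)
    with cn show ?thesis by (simp add: eq_fract)
  qed
  finally have "r = Fract (smult (inverse c) a) 1 / xvar ^ n" by (simp add: xvar_power)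
  then show "r \<in> laurent" unfolding laurent_def by blast
qed

text \<open>The generator $d$ of the ideal of polynomials vanishing at $\alpha$ is a common divisor of the
  numerators of $r$ and $s$.  If the gcd is $1$, then $d$ is a unit of the Laurent polynomial ring,
  so it divides a power of $x$, which is nonzero at $\alpha$.\<close>

lemma no_common_nonzero_zero:
  assumes "is_laurent_gcd 1 r s" "\<alpha> \<noteq> 0" "vanishes_at r \<alpha>" "vanishes_at s \<alpha>"
    and "r \<in> laurent" "s \<in> laurent"
  shows False
proof -
  define I where "I = {b :: 'a q_field poly. ac_poly b \<alpha> = 0}"
  have num: "\<exists>f n. t = Fract f (monom 1 n) \<and> f \<in> I" if "t \<in> laurent" "vanishes_at t \<alpha>" for t
  proof -
    obtain f n where t: "t = Fract f (monom 1 n)" using \<open>t \<in> laurent\<close> by (rule laurentE)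
    obtain a b where ab: "t = Fract a b" "ac_poly b \<alpha> \<noteq> 0" "ac_poly a \<alpha> = 0"
      using \<open>vanishes_at t \<alpha>\<close> unfolding vanishes_at_def by blast
    have "b \<noteq> 0" using ab by auto
    then have "f * b = a * monom 1 n" using ab t by (simp add: eq_fract)
    then have "ac_poly (f * b) \<alpha> = ac_poly (a * monom 1 n) \<alpha>" by simp
    then have "f \<in> I" using ab by (simp add: I_def)
    with t show ?thesis by blast
  qed
  obtain f m where f: "r = Fract f (monom 1 m)" "f \<in> I" using num assms by blast
  obtain g n where g: "s = Fract g (monom 1 n)" "g \<in> I" using num assms by blast
  \<comment> \<open>the ideal is nonzero, because the gcd of $0$ and $0$ is not $1$\<close>
  have "\<exists>b\<in>I. b \<noteq> 0"
  proof (rule ccontr)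
    assume "\<not> ?thesis"
    with f g have "f = 0" "g = 0" by auto
    with f g have rs: "r = 0" "s = 0" by (simp_all add: Zero_fract_def eq_fract)
    have "0 \<in> (laurent :: 'a ratfun set)" by (simp add: laurent_iff_regular_at)
    then have "laurent_dvd 0 (1::'a ratfun)"
      using assms(1) rs unfolding is_laurent_gcd_def laurent_dvd_def by auto
    then show False by (simp add: laurent_dvd_def)
  qed
  then obtain d where d: "d \<in> I" and gen: "\<And>b. b \<in> I \<Longrightarrow> d dvd b"
    by (rule field_poly_ideal_principal[of I, rotated 2]) (auto simp: I_def)
  have dvd: "laurent_dvd (Fract d 1) (Fract b (monom 1 j))" if "b \<in> I" for b j
  proof -
    from gen[OF that] obtain c where "b = d * c" by (auto elim!: dvdE)
    then have "Fract b (monom 1 j) = Fract d 1 * (Fract c 1 / xvar ^ j)" by (simp add: xvar_power)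
    then show ?thesis unfolding laurent_dvd_def laurent_def by blast
  qed
  have "Fract d 1 \<in> laurent" by (simp add: laurent_iff_regular_at)
  then have "laurent_dvd (Fract d 1) 1"
    using assms(1) dvd f g unfolding is_laurent_gcd_def by blast
  then obtain c where c: "c \<in> laurent" "1 = Fract d 1 * c" unfolding laurent_dvd_def by blast
  obtain h j where "c = Fract h (monom 1 j)" using c(1) by (rule laurentE)
  with c(2) have "Fract 1 1 = Fract (d * h) (monom 1 j)"
    by (simp flip: One_fract_def[where ?'a = "'a q_field poly"])
  then have "monom 1 j = d * h" by (subst (asm) eq_fract) auto
  then have "ac_poly (monom 1 j) \<alpha> = ac_poly (d * h) \<alpha>" by (rule arg_cong)
  with d \<open>\<alpha> \<noteq> 0\<close> show False by (simp add: I_def)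
qed

section \<open>Dilation of rational functions\<close>

lemma scale_poly_nonzero: "c \<noteq> 0 \<Longrightarrow> b \<noteq> 0 \<Longrightarrow> pcompose b [:0, c:] \<noteq> (0::'a::field poly)"
  by (simp add: pcompose_eq_0_iff)

lemma ratfun_scale_0 [simp]: "c \<noteq> 0 \<Longrightarrow> ratfun_scale c 0 = 0"
  by (simp add: Zero_fract_def ratfun_scale_Fract eq_fract)

lemma ratfun_scale_add:
  assumes "c \<noteq> 0"
  shows "ratfun_scale c (r + s) = ratfun_scale c r + ratfun_scale c s"
proof -
  obtain a b where "r = Fract a b" "b \<noteq> 0" by (rule ratfun_cases)
  moreover obtain a' b' where "s = Fract a' b'" "b' \<noteq> 0" by (rule ratfun_cases)
  ultimately show ?thesis
    using assms by (simp add: ratfun_scale_Fract scale_poly_nonzero pcompose_add pcompose_mult)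
qed

lemma ratfun_scale_mult:
  assumes "c \<noteq> 0"
  shows "ratfun_scale c (r * s) = ratfun_scale c r * ratfun_scale c s"
proof -
  obtain a b where "r = Fract a b" "b \<noteq> 0" by (rule ratfun_cases)
  moreover obtain a' b' where "s = Fract a' b'" "b' \<noteq> 0" by (rule ratfun_cases)
  ultimately show ?thesis
    using assms by (simp add: ratfun_scale_Fract pcompose_mult)
qed

lemma ratfun_scale_minus:
  assumes "c \<noteq> 0"
  shows "ratfun_scale c (- r) = - ratfun_scale c r"
  using ratfun_scale_add[OF assms, of r "- r"] assms by (simp add: eq_neg_iff_add_eq_0 add.commute)

lemma ratfun_scale_diff:
  assumes "c \<noteq> 0"
  shows "ratfun_scale c (r - s) = ratfun_scale c r - ratfun_scale c s"
  using ratfun_scale_add[OF assms, of r "- s"] ratfun_scale_minus[OF assms] by simp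

lemma ratfun_scale_scale:
  assumes "c \<noteq> 0" "d \<noteq> 0"
  shows "ratfun_scale c (ratfun_scale d r) = ratfun_scale (c * d) r"
proof -
  obtain a b where "r = Fract a b" "b \<noteq> 0" by (rule ratfun_cases)
  moreover have "pcompose (pcompose f [:0, d:]) [:0, c:] = pcompose f [:0, c * d:]" for f
    by (simp add: pcompose_assoc[symmetric] pcompose_pCons mult.commute)
  ultimately show ?thesis
    using assms by (simp add: ratfun_scale_Fract scale_poly_nonzero)
qed

lemma ratfun_scale_1 [simp]: "ratfun_scale 1 r = r"
proof -
  obtain a b where "r = Fract a b" "b \<noteq> 0" by (rule ratfun_cases)
  then show ?thesis by (simp add: ratfun_scale_Fract pcompose_idR)
qed

lemma regular_at_scale:
  assumes "c \<noteq> 0" "regular_at r (to_ac c * \<alpha>)"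
  shows "regular_at (ratfun_scale c r) \<alpha>"
proof -
  obtain a b where "r = Fract a b" "ac_poly b (to_ac c * \<alpha>) \<noteq> 0"
    using assms(2) unfolding regular_at_def by blast
  moreover from this have "b \<noteq> 0" by auto
  ultimately have "ratfun_scale c r = Fract (pcompose a [:0, c:]) (pcompose b [:0, c:])"
      "ac_poly (pcompose b [:0, c:]) \<alpha> \<noteq> 0"
    using assms(1) by (auto simp: ratfun_scale_Fract)
  then show ?thesis unfolding regular_at_def by blast
qed

lemma vanishes_at_scale:
  assumes "c \<noteq> 0" "vanishes_at r (to_ac c * \<alpha>)"
  shows "vanishes_at (ratfun_scale c r) \<alpha>"
proof -
  obtain a b where "r = Fract a b" "ac_poly b (to_ac c * \<alpha>) \<noteq> 0" "ac_poly a (to_ac c * \<alpha>) = 0"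
    using assms(2) unfolding vanishes_at_def by blast
  moreover from this have "b \<noteq> 0" by auto
  ultimately have "ratfun_scale c r = Fract (pcompose a [:0, c:]) (pcompose b [:0, c:])"
      "ac_poly (pcompose b [:0, c:]) \<alpha> \<noteq> 0" "ac_poly (pcompose a [:0, c:]) \<alpha> = 0"
    using assms(1) by (auto simp: ratfun_scale_Fract)
  then show ?thesis unfolding vanishes_at_def by blast
qed

lemma laurent_minus: "r \<in> laurent \<Longrightarrow> - r \<in> laurent"
  by (auto simp: laurent_iff_regular_at)

lemma laurent_mult: "r \<in> laurent \<Longrightarrow> s \<in> laurent \<Longrightarrow> r * s \<in> laurent"
  by (auto simp: laurent_iff_regular_at)

lemma laurent_sum: "(\<And>i. i \<in> A \<Longrightarrow> f i \<in> laurent) \<Longrightarrow> (\<Sum>i\<in>A. f i) \<in> laurent"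
  by (simp add: laurent_iff_regular_at regular_at_sum)

lemma laurent_scale: "c \<noteq> 0 \<Longrightarrow> r \<in> laurent \<Longrightarrow> ratfun_scale c r \<in> laurent"
  by (simp add: laurent_iff_regular_at regular_at_scale)

section \<open>Poles and the adjoint operator\<close>

lemma qvar_power_eq_1:
  assumes "(qvar :: 'k::field_char_0 q_field) ^ n = 1"
  shows "n = 0"
proof -
  have "monom 1 n = (1 :: 'k poly)"
    using assms by (simp add: qvar_def Fract_X_power One_fract_def eq_fract)
  then have "degree (monom (1::'k) n) = 0" by simp
  then show "n = 0" by (simp add: degree_monom_eq)
qed

lemma inj_powi:
  fixes a :: "'a::field"
  assumes "a \<noteq> 0" "\<And>n::nat. a ^ n = 1 \<Longrightarrow> n = 0"
  shows "inj (\<lambda>m::int. a powi m)"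
proof (rule injI)
  fix m n :: int
  assume eq: "a powi m = a powi n"
  have *: "k = l" if "k \<le> l" "a powi k = a powi l" for k l :: int
  proof -
    have "a powi (l - k) = 1" using that assms(1) by (simp add: power_int_diff)
    then have "a ^ nat (l - k) = 1" using \<open>k \<le> l\<close> by (simp add: power_int_def)
    then show "k = l" using assms(2) that by fastforce
  qed
  show "m = n" using *[of m n] *[of n m] eq by (cases "m \<le> n") auto
qed

text \<open>As $q$ is not a root of unity, an orbit under multiplication by powers of $q$ meets each point
  at most once.  This is what provides a first and a last pole on every orbit.\<close>

lemma finite_qorbit:
  fixes P :: "'k::field_char_0 q_field alg_closure set"
  assumes "finite P" "\<alpha> \<noteq> 0"
  shows "finite {m::int. to_ac qvar powi m * \<alpha> \<in> P}"
proof -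
  have "inj (\<lambda>m::int. to_ac (qvar :: 'k q_field) powi m)"
  proof (rule inj_powi)
    fix n assume "to_ac (qvar :: 'k q_field) ^ n = 1"
    then have "to_ac ((qvar :: 'k q_field) ^ n) = to_ac 1" by simp
    then show "n = 0" unfolding to_ac_eq_iff by (rule qvar_power_eq_1)
  qed simp
  then have "inj (\<lambda>m::int. to_ac qvar powi m * \<alpha>)"
    using assms(2) by (simp add: inj_on_def)
  then show ?thesis using finite_vimageI[OF assms(1)] by (simp add: vimage_def)
qed

text \<open>A pole of $r$ at $\alpha$ becomes a pole of the $i$-th summand at $q^i \alpha$, unless $a_i$
  cancels it.  At the two ends of an orbit of poles there is just one summand that could contribute
  a pole, so $a_0$ cancels the pole at one end and $a_J$ the pole at the other end.\<close>

lemma laurent_if_adjoint_laurent: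
  fixes L :: "'k::field_char_0 q_operator"
  assumes coeffs: "\<And>i. coeff L i \<in> laurent"
    and gcd: "\<And>i::nat. is_laurent_gcd 1 (coeff L 0) (ratfun_scale (qvar ^ i) (coeff L (degree L)))"
    and adj: "q_adjoint L r \<in> laurent"
  shows "r \<in> laurent"
proof (rule ccontr)
  let ?q = "to_ac (qvar :: 'k q_field)"
  define J where "J = degree L"
  define P where "P = {\<alpha>. \<alpha> \<noteq> 0 \<and> \<not> regular_at r \<alpha>}"
  define T where "T i = ratfun_scale (inverse (qvar ^ i)) (coeff L i * r)" for i
  have adj_eq: "q_adjoint L r = (\<Sum>i\<le>J. T i)"
    by (simp add: q_adjoint_def T_def ratfun_scale_mult J_def)
  have q0: "?q \<noteq> 0" by simp
  have coeff_reg: "regular_at (coeff L i) \<alpha>" if "\<alpha> \<noteq> 0" for i \<alpha>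
    using coeffs that by (simp add: laurent_iff_regular_at)
  have T_reg: "regular_at (T i) \<alpha>" if "\<alpha> \<noteq> 0" "?q powi (- int i) * \<alpha> \<notin> P" for i \<alpha>
    unfolding T_def using that coeff_reg
    by (intro regular_at_scale regular_at_mult) (auto simp: P_def power_int_minus)
  \<comment> \<open>no summand can be the only one that has a pole at a nonzero point\<close>
  have T_regD: "regular_at (T i) \<alpha>" if "\<alpha> \<noteq> 0" "i \<le> J"
    "\<And>j. j \<le> J \<Longrightarrow> j \<noteq> i \<Longrightarrow> ?q powi (- int j) * \<alpha> \<notin> P" for i \<alpha>
  proof -
    have "T i = q_adjoint L r - (\<Sum>j\<in>{..J} - {i}. T j)"
      using \<open>i \<le> J\<close> by (simp add: adj_eq sum_diff1)
    then show ?thesis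
      using adj that T_reg by (auto simp: laurent_iff_regular_at intro!: regular_at_diff regular_at_sum)
  qed
  assume "r \<notin> laurent"
  then obtain \<alpha>0 where \<alpha>0: "\<alpha>0 \<in> P" unfolding P_def laurent_iff_regular_at by blast
  then have \<alpha>0_nz: "\<alpha>0 \<noteq> 0" by (simp add: P_def)
  define S where "S = {m::int. ?q powi m * \<alpha>0 \<in> P}"
  have "finite P" unfolding P_def using finite_irregular[of r] by (rule rev_finite_subset) blast
  then have "finite S" unfolding S_def using \<alpha>0_nz by (rule finite_qorbit)
  moreover have "S \<noteq> {}" using \<alpha>0 by (auto simp: S_def intro: exI[of _ 0])
  ultimately have M: "Min S \<in> S" "\<And>m. m < Min S \<Longrightarrow> m \<notin> S"
    and N: "Max S \<in> S" "\<And>m. m > Max S \<Longrightarrow> m \<notin> S" and MN: "Min S \<le> Max S"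
    by (auto simp: not_less[symmetric])
  define \<alpha> where "\<alpha> = ?q powi Min S * \<alpha>0"
  define \<beta> where "\<beta> = ?q powi Max S * \<alpha>0"
  have nz: "\<alpha> \<noteq> 0" "\<beta> \<noteq> 0" using \<alpha>0_nz by (simp_all add: \<alpha>_def \<beta>_def)
  have mem_S: "m \<in> S \<longleftrightarrow> ?q powi m * \<alpha>0 \<in> P" for m
    by (simp add: S_def)
  have "\<alpha> \<in> P" "\<beta> \<in> P"
    using M(1) N(1) by (simp_all only: \<alpha>_def \<beta>_def mem_S)
  then have pole: "\<not> regular_at r \<alpha>" "\<not> regular_at r \<beta>"
    by (simp_all add: P_def)
  \<comment> \<open>the summands with $j > 0$ look at $r$ before its first pole $\<alpha>$\<close>
  have "regular_at (T 0) \<alpha>"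
  proof (rule T_regD)
    fix j :: nat assume "j \<noteq> 0"
    then have "Min S - int j \<notin> S" using M(2) by simp
    then show "?q powi (- int j) * \<alpha> \<notin> P"
      by (simp add: S_def \<alpha>_def power_int_diff power_int_minus field_simps)
  qed (use nz in auto)
  then have "regular_at (coeff L 0 * r) \<alpha>" by (simp add: T_def)
  then have van0: "vanishes_at (coeff L 0) \<alpha>"
    using coeff_reg nz pole by (intro vanishes_at_if_cancels_pole[of _ \<alpha> r]) auto
  \<comment> \<open>the summands with $j < J$ look at $r$ after its last pole $\<beta>$\<close>
  have "regular_at (T J) (?q ^ J * \<beta>)"
  proof (rule T_regD)
    fix j assume "j \<le> J" "j \<noteq> J"
    then have "Max S + (int J - int j) \<notin> S" using N(2) by simp
    then show "?q powi (- int j) * (?q ^ J * \<beta>) \<notin> P"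
      by (simp add: S_def \<beta>_def power_int_diff power_int_add power_int_minus field_simps)
  qed (use nz in auto)
  then have "regular_at (ratfun_scale (qvar ^ J) (T J)) \<beta>"
    by (intro regular_at_scale) auto
  then have "regular_at (coeff L J * r) \<beta>"
    by (simp add: T_def ratfun_scale_scale)
  then have van: "vanishes_at (coeff L J) \<beta>"
    using coeff_reg nz pole by (intro vanishes_at_if_cancels_pole[of _ \<beta> r]) auto
  define n where "n = nat (Max S - Min S)"
  have "\<beta> = ?q powi (int n + Min S) * \<alpha>0" using MN by (simp add: \<beta>_def n_def)
  then have "\<beta> = to_ac (qvar ^ n) * \<alpha>" using q0 by (simp add: \<alpha>_def power_int_add)
  then have "vanishes_at (ratfun_scale (qvar ^ n) (coeff L J)) \<alpha>"
    using van by (intro vanishes_at_scale) auto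
  then show False
    using no_common_nonzero_zero[OF gcd[of n] nz(1) van0] coeffs
    by (simp add: J_def laurent_scale)
qed

section \<open>Evaluation at powers of q\<close>

lemma ratfun_definedE:
  assumes "ratfun_defined r c"
  obtains a b where "r = Fract a b" "poly b c \<noteq> 0" "b \<noteq> 0"
  using assms unfolding ratfun_defined_def by (metis poly_0)

lemma ratfun_eval_add:
  assumes "ratfun_defined r c" "ratfun_defined s c"
  shows "ratfun_eval (r + s) c = ratfun_eval r c + ratfun_eval s c"
proof -
  obtain a b where "r = Fract a b" "poly b c \<noteq> 0" "b \<noteq> 0"
    using assms(1) by (rule ratfun_definedE)
  moreover obtain a' b' where "s = Fract a' b'" "poly b' c \<noteq> 0" "b' \<noteq> 0"
    using assms(2) by (rule ratfun_definedE)
  ultimately show ?thesis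
    by (simp add: ratfun_eval_Fract add_frac_eq)
qed

lemma ratfun_eval_mult:
  assumes "ratfun_defined r c" "ratfun_defined s c"
  shows "ratfun_eval (r * s) c = ratfun_eval r c * ratfun_eval s c"
proof -
  obtain a b where "r = Fract a b" "poly b c \<noteq> 0" "b \<noteq> 0"
    using assms(1) by (rule ratfun_definedE)
  moreover obtain a' b' where "s = Fract a' b'" "poly b' c \<noteq> 0" "b' \<noteq> 0"
    using assms(2) by (rule ratfun_definedE)
  ultimately show ?thesis
    by (simp add: ratfun_eval_Fract)
qed

lemma ratfun_eval_poly [simp]: "ratfun_eval (Fract a 1) c = poly a c"
  by (simp add: ratfun_eval_Fract)

lemma ratfun_eval_0 [simp]: "ratfun_eval 0 c = 0"
  by (simp add: Zero_fract_def)

lemma ratfun_eval_minus: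
  assumes "ratfun_defined r c"
  shows "ratfun_eval (- r) c = - ratfun_eval r c"
  using assms by (auto elim!: ratfun_definedE simp: ratfun_eval_Fract)

lemma ratfun_eval_diff:
  assumes "ratfun_defined r c" "ratfun_defined s c"
  shows "ratfun_eval (r - s) c = ratfun_eval r c - ratfun_eval s c"
proof -
  have "ratfun_defined (- s) c"
    using assms(2) by (auto simp: ratfun_defined_iff_regular_at)
  then show ?thesis
    using ratfun_eval_add[OF assms(1), of "- s"] ratfun_eval_minus[OF assms(2)] by simp
qed

lemma ratfun_eval_sum:
  assumes "\<And>i. i \<in> A \<Longrightarrow> ratfun_defined (f i) c"
  shows "ratfun_eval (\<Sum>i\<in>A. f i) c = (\<Sum>i\<in>A. ratfun_eval (f i) c)"
  using assms
proof (induction A rule: infinite_finite_induct)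
  case (insert i A)
  have "ratfun_defined (\<Sum>i\<in>A. f i) c"
    using insert.prems by (auto simp: ratfun_defined_iff_regular_at intro: regular_at_sum)
  with insert show ?case by (simp add: ratfun_eval_add)
qed auto

lemma ratfun_eval_scale:
  assumes "d \<noteq> 0" "ratfun_defined r (d * c)"
  shows "ratfun_eval (ratfun_scale d r) c = ratfun_eval r (d * c)"
proof -
  obtain a b where "r = Fract a b" "poly b (d * c) \<noteq> 0" "b \<noteq> 0"
    using assms(2) by (rule ratfun_definedE)
  with assms(1) show ?thesis
    by (simp add: ratfun_scale_Fract ratfun_eval_Fract poly_pcompose mult.commute)
qed

lemma laurent_defined: "r \<in> laurent \<Longrightarrow> c \<noteq> 0 \<Longrightarrow> ratfun_defined r c"
  by (simp add: ratfun_defined_iff_regular_at laurent_iff_regular_at)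

lemma eventually_poly_qpower_nonzero:
  fixes b :: "'k::field_char_0 q_field poly"
  assumes "b \<noteq> 0"
  shows "\<forall>\<^sub>F k in sequentially. poly b (qvar ^ k) \<noteq> 0"
proof -
  have inj: "inj (\<lambda>m::int. (qvar :: 'k q_field) powi m)"
    by (rule inj_powi) (simp_all add: qvar_power_eq_1)
  have "inj (\<lambda>k. (qvar :: 'k q_field) ^ k)"
  proof (rule injI)
    fix k l assume "(qvar :: 'k q_field) ^ k = qvar ^ l"
    then have "(qvar :: 'k q_field) powi int k = qvar powi int l" by simp
    then show "k = l" using injD[OF inj] by fastforce
  qed
  then have "finite ((\<lambda>k. qvar ^ k) -` {c. poly b c = 0})"
    using poly_roots_finite[OF assms] by (intro finite_vimageI) auto
  then show ?thesis
    unfolding cofinite_eq_sequentially[symmetric] eventually_cofinite by (simp add: vimage_def)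
qed

lemma eventually_ratfun_defined:
  fixes r :: "'k::field_char_0 ratfun"
  shows "\<forall>\<^sub>F k in sequentially. ratfun_defined r (qvar ^ k)"
proof -
  obtain a b where r: "r = Fract a b" "b \<noteq> 0" by (rule ratfun_cases)
  show ?thesis
    using eventually_poly_qpower_nonzero[OF r(2)]
    by eventually_elim (auto simp: ratfun_defined_def r(1))
qed

lemma field_embedding_0: "field_embedding h \<Longrightarrow> h 0 = 0"
  unfolding field_embedding_def by (metis add_cancel_right_right)

lemma field_embedding_add: "field_embedding h \<Longrightarrow> h (a + b) = h a + h b"
  unfolding field_embedding_def by blast

lemma field_embedding_mult: "field_embedding h \<Longrightarrow> h (a * b) = h a * h b"
  unfolding field_embedding_def by blast

lemma field_embedding_minus: "field_embedding h \<Longrightarrow> h (- a) = - h a"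
  using field_embedding_add[of h a "- a"] by (simp add: field_embedding_0 eq_neg_iff_add_eq_0 add.commute)

lemma field_embedding_diff: "field_embedding h \<Longrightarrow> h (a - b) = h a - h b"
  using field_embedding_add[of h a "- b"] by (simp add: field_embedding_minus)

lemma field_embedding_sum: "field_embedding h \<Longrightarrow> h (\<Sum>i\<in>A. f i) = (\<Sum>i\<in>A. h (f i))"
  by (induction A rule: infinite_finite_induct) (auto simp: field_embedding_0 field_embedding_add)

section \<open>Relations of smaller length than the order\<close>

lemma common_denominator:
  fixes c :: "nat \<Rightarrow> 'k::field_char_0 ratfun"
  shows "\<exists>d. d \<noteq> 0 \<and> (\<forall>i<J. \<exists>a. c i * Fract d 1 = Fract a 1)"
proof (induction J)
  case 0
  show ?case by (auto intro: exI[of _ 1])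
next
  case (Suc J)
  then obtain d where d: "d \<noteq> 0" "\<forall>i<J. \<exists>a. c i * Fract d 1 = Fract a 1" by blast
  obtain a b where ab: "c J = Fract a b" "b \<noteq> 0" by (rule ratfun_cases)
  have "\<exists>a'. c i * Fract (d * b) 1 = Fract a' 1" if "i < Suc J" for i
  proof (cases "i = J")
    case True
    have "c J * Fract (d * b) 1 = Fract (a * d) 1" using ab by (simp add: eq_fract)
    with True show ?thesis by blast
  next
    case False
    with that have "i < J" by simp
    with d obtain a' where "c i * Fract d 1 = Fract a' 1" by blast
    then have "c i * Fract d 1 * Fract b 1 = Fract (a' * b) 1" by simp
    moreover have "c i * Fract d 1 * Fract b 1 = c i * Fract (d * b) 1"
      by (simp add: mult.assoc)
    ultimately show ?thesis by auto
  qed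
  with d ab show ?case by (intro exI[of _ "d * b"]) auto
qed

text \<open>Such a relation differs from a recurrence in two respects: its coefficients have denominators,
  and it may fail for finitely many $k$.  Multiplication by a common denominator and by the
  polynomial $w$ with roots $q^0, \dots, q^{N-1}$ repairs both, and the result contradicts the
  minimality of the order unless all coefficients are zero.\<close>

lemma below_order_imp_coeffs_zero:
  fixes c :: "nat \<Rightarrow> 'k::field_char_0 ratfun"
  assumes h: "field_embedding h"
    and ev: "\<forall>\<^sub>F k in sequentially. (\<Sum>i<J. h (ratfun_eval (c i) (qvar ^ k)) * F (k + i)) = 0"
    and order: "J \<le> q_order h F"
    and "i < J"
  shows "c i = 0"
proof (rule ccontr)
  assume "c i \<noteq> 0"
  obtain d a where d: "d \<noteq> 0" and a: "\<And>i. i < J \<Longrightarrow> c i * Fract d 1 = Fract (a i) 1"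
    using common_denominator[of J c] by metis
  have "\<forall>\<^sub>F k in sequentially. \<forall>i\<in>{..<J}. ratfun_defined (c i) (qvar ^ k)"
    by (intro eventually_ball_finite ballI eventually_ratfun_defined) simp
  then have "\<forall>\<^sub>F k in sequentially. \<forall>i<J. ratfun_defined (c i) (qvar ^ k)"
    by (simp add: Ball_def)
  with ev have "\<forall>\<^sub>F k in sequentially. (\<Sum>i<J. h (ratfun_eval (c i) (qvar ^ k)) * F (k + i)) = 0 \<and>
      (\<forall>i<J. ratfun_defined (c i) (qvar ^ k))"
    by (rule eventually_conj)
  then obtain N where N: "\<And>k. k \<ge> N \<Longrightarrow> (\<Sum>i<J. h (ratfun_eval (c i) (qvar ^ k)) * F (k + i)) = 0"
      "\<And>k i. k \<ge> N \<Longrightarrow> i < J \<Longrightarrow> ratfun_defined (c i) (qvar ^ k)"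
    unfolding eventually_sequentially by blast
  define w where "w = (\<Prod>k<N. [:- (qvar ^ k), 1:] :: 'k q_field poly)"
  have w: "w \<noteq> 0" "\<And>k. k < N \<Longrightarrow> poly w (qvar ^ k) = 0"
    by (auto simp: w_def poly_prod)
  define M where "M = (\<Sum>i<J. monom (Fract (a i * w) 1) i)"
  have coeff_M: "coeff M j = (if j < J then Fract (a j * w) 1 else 0)" for j
    by (simp add: M_def coeff_sum)
  have "a i \<noteq> 0"
  proof
    assume "a i = 0"
    then have "c i * Fract d 1 = 0" using a[OF \<open>i < J\<close>] by (simp add: Zero_fract_def)
    moreover have "Fract d 1 \<noteq> 0" using d by (simp add: Zero_fract_def eq_fract)
    ultimately show False using \<open>c i \<noteq> 0\<close> by simp
  qed
  then have "Fract (a i * w) 1 \<noteq> 0" using w by (simp add: Zero_fract_def eq_fract)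
  then have "coeff M i \<noteq> 0" using \<open>i < J\<close> by (simp add: coeff_M)
  then have "M \<noteq> 0" by auto
  have deg: "degree M < J"
    using \<open>i < J\<close> by (intro degree_lessI) (auto simp: coeff_M)
  have "q_apply h M F k = 0" for k
  proof -
    have "q_apply h M F k = (\<Sum>j\<le>degree M. h (ratfun_eval (coeff M j) (qvar ^ k)) * F (k + j))"
      by (simp add: q_apply_def)
    also have "\<dots> = (\<Sum>j<J. h (ratfun_eval (coeff M j) (qvar ^ k)) * F (k + j))"
      using deg by (intro sum.mono_neutral_left) (auto simp: coeff_eq_0 field_embedding_0[OF h])
    also have "\<dots> = (\<Sum>j<J. h (poly (a j) (qvar ^ k)) * h (poly w (qvar ^ k)) * F (k + j))"
      by (intro sum.cong) (auto simp: coeff_M field_embedding_mult[OF h])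
    also have "\<dots> = 0"
    proof (cases "k < N")
      case True
      then show ?thesis by (simp add: w field_embedding_0[OF h])
    next
      case False
      have "poly (a j) (qvar ^ k) = ratfun_eval (c j) (qvar ^ k) * poly d (qvar ^ k)" if "j < J" for j
      proof -
        have "ratfun_eval (c j * Fract d 1) (qvar ^ k) = poly (a j) (qvar ^ k)"
          using a[OF that] by simp
        moreover have "ratfun_defined (Fract d 1) (qvar ^ k)"
          by (simp add: ratfun_defined_iff_regular_at)
        ultimately show ?thesis
          using N(2)[of k j] False that by (simp add: ratfun_eval_mult)
      qed
      then have "(\<Sum>j<J. h (poly (a j) (qvar ^ k)) * h (poly w (qvar ^ k)) * F (k + j)) =
          h (poly d (qvar ^ k)) * h (poly w (qvar ^ k)) *
            (\<Sum>j<J. h (ratfun_eval (c j) (qvar ^ k)) * F (k + j))"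
        by (simp add: sum_distrib_left field_embedding_mult[OF h] mult_ac)
      then show ?thesis using N(1)[of k] False by simp
    qed
    finally show ?thesis .
  qed
  then have "M \<in> q_ann h F"
    by (auto simp: q_ann_def coeff_M laurent_iff_regular_at)
  then have "has_q_recurrence h F (degree M)"
    using \<open>M \<noteq> 0\<close> unfolding has_q_recurrence_def by (intro bexI[of _ M]) auto
  then have "q_order h F \<le> degree M"
    unfolding q_order_def by (rule Least_le)
  with deg order show False by simp
qed

section \<open>Summation by parts\<close>

lemma sum_triangle_swap:
  "(\<Sum>j<J. \<Sum>i\<in>{j<..J::nat}. f i j) = (\<Sum>i\<le>J. \<Sum>j<i. f i j :: 'a::comm_monoid_add)"
  by (simp add: sum.Sigma) (rule sum.reindex_bij_witness[of _ "\<lambda>(i, j). (j, i)" "\<lambda>(j, i). (i, j)"]; auto)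

text \<open>The second argument of $B$ is an integer because arguments $k - i$ with $k < i$ occur; these
  correspond to evaluation at negative powers of $q$.  For fixed $i$, the terms
  $B_i(k + j - i) F_{k+j}$ with $j < i$ telescope, because passing from $k$ to $k + 1$ has the same
  effect as passing from $j$ to $j + 1$.\<close>

lemma summation_by_parts:
  fixes B :: "nat \<Rightarrow> int \<Rightarrow> 'e::comm_ring_1" and F :: "nat \<Rightarrow> 'e"
  shows "(\<Sum>i\<le>J. B i (int k - int i)) * F k - (\<Sum>i\<le>J. B i (int k) * F (k + i)) =
    fwd_diff (\<lambda>k. \<Sum>j<J. - (\<Sum>i\<in>{j<..J}. B i (int k + int j - int i)) * F (k + j)) k"
proof -
  define g where "g k i j = B i (int k + int j - int i) * F (k + j)" for k i j
  have inner: "(\<Sum>j<J. - (\<Sum>i\<in>{j<..J}. B i (int k + int j - int i)) * F (k + j)) =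
      - (\<Sum>i\<le>J. \<Sum>j<i. g k i j)" for k
    by (simp add: sum_triangle_swap[symmetric] g_def sum_distrib_right sum_negf)
  have tele: "(\<Sum>j<i. g (Suc k) i j) - (\<Sum>j<i. g k i j) = B i (int k) * F (k + i) - B i (int k - int i) * F k"
    for i
  proof -
    have "g (Suc k) i j = g k i (Suc j)" for j by (simp add: g_def algebra_simps)
    then have "(\<Sum>j<i. g (Suc k) i j) - (\<Sum>j<i. g k i j) = (\<Sum>j<i. g k i (Suc j) - g k i j)"
      by (simp add: sum_subtractf)
    also have "\<dots> = g k i i - g k i 0" by (rule sum_lessThan_telescope)
    finally show ?thesis by (simp add: g_def)
  qed
  have "fwd_diff (\<lambda>k. \<Sum>j<J. - (\<Sum>i\<in>{j<..J}. B i (int k + int j - int i)) * F (k + j)) k =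
      - (\<Sum>i\<le>J. (\<Sum>j<i. g (Suc k) i j) - (\<Sum>j<i. g k i j))"
    unfolding fwd_diff_def inner by (simp add: sum_subtractf)
  also have "\<dots> = (\<Sum>i\<le>J. B i (int k - int i)) * F k - (\<Sum>i\<le>J. B i (int k) * F (k + i))"
    by (simp add: tele sum_subtractf sum_distrib_right)
  finally show ?thesis by simp
qed

section \<open>Telescoping relations and the adjoint operator\<close>

text \<open>Summation by parts with $B_i(m) = (a_i p)(q^m)$ yields the certificate
  $u_j(x) = - \sum_{j < i \le J} (a_i p)(q^{j-i} x)$.  It consists of Laurent polynomials, so its
  values exist at every power of $q$ and no $k$ has to be excluded.\<close>

lemma adjoint_imp_telescoping:
  fixes h :: "'k::field_char_0 q_field \<Rightarrow> 'e::field"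
  assumes h: "field_embedding h" and ann: "L \<in> q_ann h F" and p: "p \<in> laurent"
  obtains u where "\<And>j. u j \<in> laurent"
    "\<And>k. h (ratfun_eval (q_adjoint L p) (qvar ^ k)) * F k =
       fwd_diff (\<lambda>k. \<Sum>j<degree L. h (ratfun_eval (u j) (qvar ^ k)) * F (k + j)) k"
proof -
  define J where "J = degree L"
  define b where "b i = coeff L i * p" for i
  define B where "B i m = h (ratfun_eval (b i) (qvar powi m))" for i m
  define u where "u j = - (\<Sum>i\<in>{j<..J}. ratfun_scale (inverse (qvar ^ (i - j))) (b i))" for j
  have coeffs: "coeff L i \<in> laurent" for i
    using ann by (simp add: q_ann_def)
  have b: "b i \<in> laurent" for i
    unfolding b_def using coeffs p by (rule laurent_mult)
  have scale: "ratfun_scale (inverse (qvar ^ n)) (b i) \<in> laurent" for i n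
    by (rule laurent_scale[OF _ b]) simp
  have eval_scale: "ratfun_eval (ratfun_scale (inverse (qvar ^ n)) (b i)) (qvar ^ k) =
      ratfun_eval (b i) (qvar powi (int k - int n))" for i n k
    by (subst ratfun_eval_scale)
      (auto intro: laurent_defined[OF b] simp: power_int_diff field_simps)
  have u: "u j \<in> laurent" for j
    unfolding u_def using scale by (intro laurent_minus laurent_sum)
  have eval_u: "h (ratfun_eval (u j) (qvar ^ k)) = - (\<Sum>i\<in>{j<..J}. B i (int k + int j - int i))" for j k
  proof -
    have "ratfun_eval (u j) (qvar ^ k) =
        - (\<Sum>i\<in>{j<..J}. ratfun_eval (b i) (qvar powi (int k - int (i - j))))"
      unfolding u_def
      by (simp add: ratfun_eval_minus ratfun_eval_sum laurent_defined laurent_sum scale eval_scale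
        del: of_nat_diff)
    also have "\<dots> = - (\<Sum>i\<in>{j<..J}. ratfun_eval (b i) (qvar powi (int k + int j - int i)))"
      by (intro arg_cong[of _ _ uminus] sum.cong) (auto simp: of_nat_diff algebra_simps)
    finally show ?thesis
      by (simp add: B_def field_embedding_minus[OF h] field_embedding_sum[OF h])
  qed
  have eval_adj: "h (ratfun_eval (q_adjoint L p) (qvar ^ k)) = (\<Sum>i\<le>J. B i (int k - int i))" for k
  proof -
    have "q_adjoint L p = (\<Sum>i\<le>J. ratfun_scale (inverse (qvar ^ i)) (b i))"
      by (simp add: q_adjoint_def b_def J_def ratfun_scale_mult)
    then show ?thesis
      by (simp add: ratfun_eval_sum laurent_defined scale eval_scale B_def field_embedding_sum[OF h])
  qed
  have rec: "(\<Sum>i\<le>J. B i (int k) * F (k + i)) = 0" for k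
  proof -
    have "(\<Sum>i\<le>J. B i (int k) * F (k + i)) = h (ratfun_eval p (qvar ^ k)) * q_apply h L F k"
      by (simp add: B_def b_def ratfun_eval_mult laurent_defined coeffs p field_embedding_mult[OF h]
        q_apply_def J_def sum_distrib_left mult_ac)
    then show ?thesis using ann by (simp add: q_ann_def)
  qed
  have "h (ratfun_eval (q_adjoint L p) (qvar ^ k)) * F k =
      fwd_diff (\<lambda>k. \<Sum>j<J. h (ratfun_eval (u j) (qvar ^ k)) * F (k + j)) k" for k
    using summation_by_parts[where B = B and J = J and k = k and F = F] by (simp add: rec eval_adj eval_u)
  with u show thesis using that J_def by blast
qed

text \<open>Written out, the relation reads $\sum_{i \le J} c_i(q^k) F_{k+i} = 0$ with
  $c_i(x) = u_{i-1}(q x) - u_i(x) - [i = 0]\, t(x)$, where $u_{-1} = u_J = 0$.  By minimality of the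
  order, $c_i = r a_i$.  In $L^*(r) = \sum_i c_i(q^{-i} x)$ the contributions
  $u_{i-1}(q^{1-i} x)$ and $u_i(q^{-i} x)$ cancel, so $L^*(r) = -t$.\<close>

lemma telescoping_imp_rational_adjoint:
  fixes h :: "'k::field_char_0 q_field \<Rightarrow> 'e::field"
  assumes h: "field_embedding h" and ann: "L \<in> q_ann h F"
    and L: "L \<noteq> 0" and order: "degree L \<le> q_order h F"
    and tele: "\<forall>\<^sub>F k in sequentially. h (ratfun_eval t (qvar ^ k)) * F k =
      fwd_diff (\<lambda>k. \<Sum>i<degree L. h (ratfun_eval (u i) (qvar ^ k)) * F (k + i)) k"
  shows "\<exists>r. t = q_adjoint L r"
proof -
  define J where "J = degree L"
  define V where "V i = (case i of 0 \<Rightarrow> 0 | Suc j \<Rightarrow> ratfun_scale qvar (u j))" for i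
  define U where "U i = (if i < J then u i else 0)" for i
  define W where "W i = (if i = 0 then t else 0)" for i :: nat
  define c where "c i = V i - U i - W i" for i
  \<comment> \<open>chosen so that subtracting $r L$ removes the term with $F_{k+J}$\<close>
  define r where "r = c J / coeff L J"
  define e where "e i = c i - r * coeff L i" for i
  have lead: "coeff L J \<noteq> 0" using L by (simp add: J_def)
  have eJ: "e J = 0" using lead by (simp add: e_def r_def)
  have defd: "\<forall>\<^sub>F k in sequentially. \<forall>i\<in>{..J}. ratfun_defined (f i) (qvar ^ k)"
    for f :: "nat \<Rightarrow> 'k ratfun"
    by (intro eventually_ball_finite ballI eventually_ratfun_defined) simp
  have "\<forall>\<^sub>F k in sequentially. (\<Sum>i<J. h (ratfun_eval (e i) (qvar ^ k)) * F (k + i)) = 0"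
    using tele defd[of V] defd[of U] defd[of W] defd[of c] defd[of u] eventually_ratfun_defined[of r]
      eventually_all_ge_at_top[OF defd[of u]]
  proof eventually_elim
    case (elim k)
    define x where "x = (qvar ^ k :: 'k q_field)"
    have x: "x \<noteq> 0" by (simp add: x_def)
    have coeffs: "ratfun_defined (coeff L i) x" for i
      using ann x by (intro laurent_defined) (auto simp: q_ann_def)
    have VU: "ratfun_defined (V i - U i) x" if "i \<le> J" for i
      using elim that by (auto simp: ratfun_defined_iff_regular_at x_def)
    have eval_c: "ratfun_eval (c i) x = ratfun_eval (V i) x - ratfun_eval (U i) x - ratfun_eval (W i) x"
      if "i \<le> J" for i
      using elim that VU by (simp add: c_def ratfun_eval_diff x_def)
    have rL: "ratfun_defined (r * coeff L i) x" for i
      using elim coeffs[of i] by (auto simp: ratfun_defined_iff_regular_at x_def)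
    have eval_e: "ratfun_eval (e i) x = ratfun_eval (c i) x - ratfun_eval r x * ratfun_eval (coeff L i) x"
      if "i \<le> J" for i
      using elim that rL coeffs by (simp add: e_def ratfun_eval_diff ratfun_eval_mult x_def)
    have V: "(\<Sum>i\<le>J. h (ratfun_eval (V i) x) * F (k + i)) =
        (\<Sum>i<J. h (ratfun_eval (u i) (qvar ^ Suc k)) * F (Suc k + i))"
    proof -
      have "ratfun_eval (V (Suc i)) x = ratfun_eval (u i) (qvar ^ Suc k)" if "i < J" for i
      proof -
        have "\<forall>n\<ge>k. \<forall>i\<in>{..J}. ratfun_defined (u i) (qvar ^ n)"
          using elim by blast
        then have "ratfun_defined (u i) (qvar ^ Suc k)"
          using that by (auto dest: spec[of _ "Suc k"] simp del: power_Suc)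
        then show ?thesis by (simp add: V_def x_def ratfun_eval_scale)
      qed
      moreover have "ratfun_eval (V 0) x = 0" by (simp add: V_def)
      ultimately show ?thesis by (simp add: sum.atMost_shift field_embedding_0[OF h])
    qed
    have U: "(\<Sum>i\<le>J. h (ratfun_eval (U i) x) * F (k + i)) = (\<Sum>i<J. h (ratfun_eval (u i) x) * F (k + i))"
      by (simp add: U_def field_embedding_0[OF h] flip: lessThan_Suc_atMost)
    have W: "(\<Sum>i\<le>J. h (ratfun_eval (W i) x) * F (k + i)) = h (ratfun_eval t x) * F k"
      by (simp add: W_def sum.atMost_shift field_embedding_0[OF h])
    have "(\<Sum>i\<le>J. h (ratfun_eval (c i) x) * F (k + i)) =
        (\<Sum>i\<le>J. h (ratfun_eval (V i) x) * F (k + i)) - (\<Sum>i\<le>J. h (ratfun_eval (U i) x) * F (k + i))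
          - (\<Sum>i\<le>J. h (ratfun_eval (W i) x) * F (k + i))"
      by (simp add: eval_c field_embedding_diff[OF h] left_diff_distrib sum_subtractf)
    also have "\<dots> = 0"
      using elim(1) unfolding V U W by (simp add: fwd_diff_def x_def J_def)
    finally have c: "(\<Sum>i\<le>J. h (ratfun_eval (c i) x) * F (k + i)) = 0" .
    have apply_L: "q_apply h L F k = (\<Sum>i\<le>J. h (ratfun_eval (coeff L i) x) * F (k + i))"
      by (simp add: q_apply_def J_def x_def)
    have "(\<Sum>i<J. h (ratfun_eval (e i) x) * F (k + i)) = (\<Sum>i\<le>J. h (ratfun_eval (e i) x) * F (k + i))"
      by (simp add: eJ field_embedding_0[OF h] flip: lessThan_Suc_atMost)
    also have "\<dots> = (\<Sum>i\<le>J. h (ratfun_eval (c i) x) * F (k + i)) - h (ratfun_eval r x) * q_apply h L F k"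
      by (simp add: eval_e field_embedding_diff[OF h] field_embedding_mult[OF h] left_diff_distrib
        sum_subtractf apply_L sum_distrib_left mult.assoc)
    also have "\<dots> = 0" using c ann by (simp add: q_ann_def)
    finally show ?case by (simp add: x_def)
  qed
  then have "e i = 0" if "i < J" for i
    using below_order_imp_coeffs_zero[OF h _ _ that] order by (simp add: J_def)
  with eJ have cr: "c i = r * coeff L i" if "i \<le> J" for i
    using that by (cases "i = J") (auto simp: e_def)
  let ?S = "\<lambda>i. ratfun_scale (inverse (qvar ^ i))"
  have "q_adjoint L r = (\<Sum>i\<le>J. ?S i (c i))"
    by (simp add: q_adjoint_def cr J_def ratfun_scale_mult mult.commute)
  also have "\<dots> = (\<Sum>i\<le>J. ?S i (V i)) - (\<Sum>i\<le>J. ?S i (U i)) - (\<Sum>i\<le>J. ?S i (W i))"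
    by (simp add: c_def ratfun_scale_diff sum_subtractf)
  also have "(\<Sum>i\<le>J. ?S i (V i)) = (\<Sum>i<J. ?S i (u i))"
  proof -
    have "inverse (qvar ^ Suc i) * qvar = inverse (qvar ^ i :: 'k q_field)" for i
      by (simp add: field_simps)
    then show ?thesis
      by (simp add: sum.atMost_shift V_def ratfun_scale_scale del: power_Suc)
  qed
  also have "(\<Sum>i\<le>J. ?S i (U i)) = (\<Sum>i<J. ?S i (u i))"
    by (simp add: U_def flip: lessThan_Suc_atMost)
  also have "(\<Sum>i\<le>J. ?S i (W i)) = t"
    by (simp add: sum.atMost_shift W_def)
  finally have "q_adjoint L (- r) = t"
    by (simp add: q_adjoint_def ratfun_scale_minus sum_negf)
  then show ?thesis by blast
qed

theorem theorem4:
  fixes h :: "'k::field_char_0 q_field \<Rightarrow> 'e::field"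
    and F :: "nat \<Rightarrow> 'e"
    and J :: nat
    and L :: "'k q_operator"
    and pt :: "'k ratfun"
  assumes "field_embedding h"
    and "q_holonomic h F"
    and "q_order h F = J"
    and "L \<in> q_ann h F"
    and "degree L \<le> J"
    and "\<forall>i::nat. is_laurent_gcd 1 (coeff L 0) (ratfun_scale (qvar ^ i) (coeff L J))"
    and "pt \<in> laurent"
  shows "(\<exists>u :: nat \<Rightarrow> 'k ratfun. \<forall>k.
            (\<forall>i<J. ratfun_defined (u i) (qvar ^ k) \<and> ratfun_defined (u i) (qvar ^ Suc k)) \<longrightarrow>
            h (ratfun_eval pt (qvar ^ k)) * F k =
              fwd_diff (\<lambda>k. \<Sum>i<J. h (ratfun_eval (u i) (qvar ^ k)) * F (k + i)) k)
         \<longleftrightarrow> (\<exists>p\<in>laurent. pt = q_adjoint L p)"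
proof -
  \<comment> \<open>the gcd of $0$ and $0$ is not $1$\<close>
  have "L \<noteq> 0"
  proof
    assume "L = 0"
    then have "is_laurent_gcd 1 0 (0 :: 'k ratfun)"
      using assms(6) by (metis coeff_0 mult_1 power_0 ratfun_scale_1)
    then have "laurent_dvd 0 (1 :: 'k ratfun)"
      by (auto simp: is_laurent_gcd_def laurent_dvd_def)
    then show False by (simp add: laurent_dvd_def)
  qed
  \<comment> \<open>minimality of the order excludes a leading coefficient below position $J$\<close>
  have "has_q_recurrence h F (degree L)"
    using assms(4) \<open>L \<noteq> 0\<close> unfolding has_q_recurrence_def by (intro bexI[of _ L]) auto
  then have "J \<le> degree L"
    unfolding assms(3)[symmetric] q_order_def by (rule Least_le)
  with assms(5) have deg: "degree L = J" by simp
  show ?thesis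
  proof
    assume "\<exists>p\<in>laurent. pt = q_adjoint L p"
    then obtain p where p: "p \<in> laurent" "pt = q_adjoint L p" by blast
    show "\<exists>u :: nat \<Rightarrow> 'k ratfun. \<forall>k.
            (\<forall>i<J. ratfun_defined (u i) (qvar ^ k) \<and> ratfun_defined (u i) (qvar ^ Suc k)) \<longrightarrow>
            h (ratfun_eval pt (qvar ^ k)) * F k =
              fwd_diff (\<lambda>k. \<Sum>i<J. h (ratfun_eval (u i) (qvar ^ k)) * F (k + i)) k"
    proof -
      obtain u where "\<And>k. h (ratfun_eval (q_adjoint L p) (qvar ^ k)) * F k =
          fwd_diff (\<lambda>k. \<Sum>j<degree L. h (ratfun_eval (u j) (qvar ^ k)) * F (k + j)) k"
        using adjoint_imp_telescoping[OF assms(1,4) p(1)] by blast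
      then show ?thesis unfolding p(2) deg by blast
    qed
  next
    assume "\<exists>u :: nat \<Rightarrow> 'k ratfun. \<forall>k.
            (\<forall>i<J. ratfun_defined (u i) (qvar ^ k) \<and> ratfun_defined (u i) (qvar ^ Suc k)) \<longrightarrow>
            h (ratfun_eval pt (qvar ^ k)) * F k =
              fwd_diff (\<lambda>k. \<Sum>i<J. h (ratfun_eval (u i) (qvar ^ k)) * F (k + i)) k"
    then obtain u :: "nat \<Rightarrow> 'k ratfun" where u: "\<And>k.
            (\<forall>i<J. ratfun_defined (u i) (qvar ^ k) \<and> ratfun_defined (u i) (qvar ^ Suc k)) \<Longrightarrow>
            h (ratfun_eval pt (qvar ^ k)) * F k =
              fwd_diff (\<lambda>k. \<Sum>i<J. h (ratfun_eval (u i) (qvar ^ k)) * F (k + i)) k"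
      by blast
    have "\<forall>\<^sub>F k in sequentially. \<forall>i\<in>{..<J}. ratfun_defined (u i) (qvar ^ k)"
      by (intro eventually_ball_finite ballI eventually_ratfun_defined) simp
    then have "\<forall>\<^sub>F k in sequentially. \<forall>n\<ge>k. \<forall>i\<in>{..<J}. ratfun_defined (u i) (qvar ^ n)"
      by (rule eventually_all_ge_at_top)
    then have "\<forall>\<^sub>F k in sequentially. h (ratfun_eval pt (qvar ^ k)) * F k =
        fwd_diff (\<lambda>k. \<Sum>i<J. h (ratfun_eval (u i) (qvar ^ k)) * F (k + i)) k"
      by (rule eventually_mono) (rule u, auto simp del: power_Suc)
    then have "\<exists>r. pt = q_adjoint L r"
      using assms(3) deg
      by (intro telescoping_imp_rational_adjoint[OF assms(1,4) \<open>L \<noteq> 0\<close>, where u = u]) simp_all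
    then obtain r where r: "pt = q_adjoint L r" by blast
    moreover have "r \<in> laurent"
    proof (rule laurent_if_adjoint_laurent)
      show "coeff L i \<in> laurent" for i
        using assms(4) by (simp add: q_ann_def)
      show "is_laurent_gcd 1 (coeff L 0) (ratfun_scale (qvar ^ i) (coeff L (degree L)))" for i
        unfolding deg using assms(6) by (rule spec)
      show "q_adjoint L r \<in> laurent"
        using assms(7) unfolding r .
    qed
    ultimately show "\<exists>p\<in>laurent. pt = q_adjoint L p" by blast
  qed
qed

end
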